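(* For any positive integers $n,\lambda$ with $n\geq \lambda$, there exists a directed graph $G$ on $n$ vertices with a source $s$, a sink $t$, and an $(s,t)$-min-cut of size $\lambda$, such that any dual fault-tolerant min-cut oracle for $G$ requires $\Omega(\lambda n)$ space.
   Context: Graphs are directed unweighted multigraphs with unit edge capacities. A dual fault-tolerant min-cut oracle for $G$ is a data structure that, given any set $F$ of two edges of $G$, reports the size of an $(s,t)$-min-cut in $G-F$ (the graph with the edges of $F$ deleted). *)

theory Defs
  imports Complex_Main "Graph_Theory.Digraph"
begin

text \<open>The arc \<open>(u, v, i)\<close> is the \<open>i\<close>-th parallel arc from \<open>u\<close> to \<open>v\<close>. Parallel arcs thus stay
  distinct, and naming an arc in a query also tells the oracle its endpoints.\<close>

type_synonym marc = "nat \<times> nat \<times> nat"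
type_synonym multidigraph = "(nat, marc) pre_digraph"

definition multidigraph_on :: "nat \<Rightarrow> multidigraph \<Rightarrow> bool" where
  "multidigraph_on n G \<longleftrightarrow>
     fin_digraph G \<and> verts G = {..<n} \<and>
     tail G = (\<lambda>(u, v, i). u) \<and> head G = (\<lambda>(u, v, i). v)"

definition del_arcs :: "('a, 'b) pre_digraph \<Rightarrow> 'b set \<Rightarrow> ('a, 'b) pre_digraph" where
  "del_arcs G F = G\<lparr>arcs := arcs G - F\<rparr>"

definition st_cuts :: "('a, 'b) pre_digraph \<Rightarrow> 'a \<Rightarrow> 'a \<Rightarrow> 'a set set" where
  "st_cuts G s t = {C. C \<subseteq> verts G \<and> s \<in> C \<and> t \<notin> C}"

definition cut_size :: "('a, 'b) pre_digraph \<Rightarrow> 'a set \<Rightarrow> nat" where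
  "cut_size G C = card {a \<in> arcs G. tail G a \<in> C \<and> head G a \<notin> C}"

definition min_cut_size :: "('a, 'b) pre_digraph \<Rightarrow> 'a \<Rightarrow> 'a \<Rightarrow> nat" where
  "min_cut_size G s t = Min (cut_size G ` st_cuts G s t)"

text \<open>The machine that executes queries: it maps the stored bits, the terminals and the failed
  arcs to the reported value. It is an arbitrary function, so query time and computability play
  no role. An oracle is the bit string (data and, if desired, program) that the machine runs on.\<close>

type_synonym machine = "bool list \<Rightarrow> nat \<Rightarrow> nat \<Rightarrow> marc set \<Rightarrow> nat"

definition dual_ft_oracle :: "machine \<Rightarrow> multidigraph \<Rightarrow> nat \<Rightarrow> nat \<Rightarrow> bool list \<Rightarrow> bool" where
  "dual_ft_oracle M G s t D \<longleftrightarrow>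
     (\<forall>F \<subseteq> arcs G. card F = 2 \<longrightarrow> M D s t F = min_cut_size (del_arcs G F) s t)"

end

theory Submission
  imports Defs "Graph_Theory.Arc_Walk" "HOL-Library.Disjoint_Sets"
begin

text \<open>
  A block has an entry, an exit and \<open>2r\<close> inner vertices \<open>a\<^sub>i\<close>, \<open>b\<^sub>j\<close> (\<open>i, j < r\<close>), each on its own
  path entry--inner--exit of length two, and it carries an arc \<open>a\<^sub>i \<rightarrow> b\<^sub>j\<close> for each \<open>(i, j)\<close> in an
  arbitrary relation. When \<open>a\<^sub>i \<rightarrow> exit\<close> and \<open>entry \<rightarrow> b\<^sub>j\<close> fail, the arc \<open>a\<^sub>i \<rightarrow> b\<^sub>j\<close> joins the remains
  of the two broken paths into a new one, so the block loses one unit of capacity if \<open>(i, j)\<close> is in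
  the relation and two units otherwise. A block thus stores \<open>r\<^sup>2\<close> bits on \<open>O(r)\<close> vertices. With
  \<open>r \<approx> \<lambda>/4\<close> and \<open>\<Theta>(n/\<lambda>)\<close> blocks in series, followed by a bundle of \<open>\<lambda>\<close> parallel arcs, \<open>\<Omega>(\<lambda> n)\<close>
  bits can be recovered from the answers. Since there are fewer than \<open>2^m\<close> bit strings shorter than
  \<open>m\<close>, one of the encoded graphs has only large oracles.
\<close>

section \<open>Counting bit strings\<close>

lemma finite_bool_lists_length_less: "finite {D :: bool list. length D < m}"
  by (rule finite_subset[OF _ finite_lists_length_le[of UNIV m]]) auto

lemma card_bool_lists_length_less: "card {D :: bool list. length D < m} < 2 ^ m"
proof (induction m)
  case 0
  show ?case by simp
next
  case (Suc m)
  have "{D :: bool list. length D < Suc m} = {D. length D < m} \<union> {D. length D = m}"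
    by auto
  moreover have "card {D :: bool list. length D = m} = 2 ^ m"
    using card_lists_length_eq[of "UNIV :: bool set" m] by simp
  ultimately have "card {D :: bool list. length D < Suc m} \<le>
      card {D :: bool list. length D < m} + 2 ^ m"
    by (metis card_Un_le)
  with Suc.IH show ?case by simp
qed

lemma exists_only_long_codes:
  fixes codes :: "bool list \<Rightarrow> 'a \<Rightarrow> bool"
  assumes many: "2 ^ m \<le> card X"
    and decodable: "\<And>x y D. \<lbrakk>x \<in> X; y \<in> X; codes D x; codes D y\<rbrakk> \<Longrightarrow> x = y"
  shows "\<exists>x \<in> X. \<forall>D. codes D x \<longrightarrow> m \<le> length D"
proof (rule ccontr)
  assume "\<not> ?thesis"
  then have "\<forall>x \<in> X. \<exists>D. codes D x \<and> length D < m"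
    by (auto simp: not_le)
  then obtain code where code: "\<And>x. x \<in> X \<Longrightarrow> codes (code x) x \<and> length (code x) < m"
    by metis
  have "inj_on code X"
    by (rule inj_onI) (metis code decodable)
  moreover have "code ` X \<subseteq> {D. length D < m}"
    using code by auto
  ultimately have "card X \<le> card {D :: bool list. length D < m}"
    using finite_bool_lists_length_less by (rule card_inj_on_le)
  with many card_bool_lists_length_less[of m] show False
    by simp
qed

section \<open>Cuts and arc-disjoint walks\<close>

definition cut_arcs :: "('a, 'b) pre_digraph \<Rightarrow> 'a set \<Rightarrow> 'b set" where
  "cut_arcs G C = {a \<in> arcs G. tail G a \<in> C \<and> head G a \<notin> C}"

lemma cut_size_eq_card_cut_arcs: "cut_size G C = card (cut_arcs G C)"
  by (simp add: cut_size_def cut_arcs_def)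

lemma del_arcs_simps [simp]:
  "verts (del_arcs G F) = verts G"
  "arcs (del_arcs G F) = arcs G - F"
  "tail (del_arcs G F) = tail G"
  "head (del_arcs G F) = head G"
  by (simp_all add: del_arcs_def)

lemma del_arcs_empty [simp]: "del_arcs G {} = G"
  by (simp add: del_arcs_def)

lemma st_cuts_del_arcs [simp]: "st_cuts (del_arcs G F) s t = st_cuts G s t"
  by (simp add: st_cuts_def)

lemma cut_size_del_arcs:
  assumes "finite F" and "F \<subseteq> cut_arcs G C"
  shows "cut_size (del_arcs G F) C = cut_size G C - card F"
proof -
  have "cut_arcs (del_arcs G F) C = cut_arcs G C - F"
    by (auto simp: cut_arcs_def)
  with assms show ?thesis
    by (simp add: cut_size_eq_card_cut_arcs card_Diff_subset)
qed

lemma finite_st_cuts: "finite (verts G) \<Longrightarrow> finite (st_cuts G s t)"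
  unfolding st_cuts_def by (rule finite_subset[of _ "Pow (verts G)"]) auto

lemma min_cut_size_le:
  assumes "finite (verts G)" and "C \<in> st_cuts G s t"
  shows "min_cut_size G s t \<le> cut_size G C"
  unfolding min_cut_size_def using assms by (simp add: finite_st_cuts)

definition arc_connected :: "('a, 'b) pre_digraph \<Rightarrow> nat \<Rightarrow> 'a \<Rightarrow> 'a \<Rightarrow> bool" where
  "arc_connected G k u v \<longleftrightarrow> (\<forall>C \<in> st_cuts G u v. k \<le> cut_size G C)"

lemma le_min_cut_size_iff:
  assumes "finite (verts G)" and "s \<in> verts G" and "s \<noteq> t"
  shows "k \<le> min_cut_size G s t \<longleftrightarrow> arc_connected G k s t"
proof -
  have "{s} \<in> st_cuts G s t"
    using assms(2,3) by (simp add: st_cuts_def)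
  then have "st_cuts G s t \<noteq> {}"
    by auto
  with assms(1) show ?thesis
    by (simp add: min_cut_size_def arc_connected_def finite_st_cuts)
qed

lemma arc_connected_mono: "arc_connected G k u v \<Longrightarrow> m \<le> k \<Longrightarrow> arc_connected G m u v"
  unfolding arc_connected_def by (meson order_trans)

lemma arc_connected_refl: "arc_connected G k u u"
  by (simp add: arc_connected_def st_cuts_def)

lemma arc_connected_trans:
  "arc_connected G k u v \<Longrightarrow> arc_connected G k v w \<Longrightarrow> v \<in> verts G \<Longrightarrow> arc_connected G k u w"
  unfolding arc_connected_def st_cuts_def by blast

lemma arc_connected_chain:
  assumes "\<And>l. l < m \<Longrightarrow> arc_connected G k (x l) (x (Suc l))"
    and "\<And>l. l < m \<Longrightarrow> x l \<in> verts G"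
  shows "arc_connected G k (x 0) (x m)"
  using assms
proof (induction m)
  case 0
  show ?case by (rule arc_connected_refl)
next
  case (Suc m)
  then show ?case
    by (meson arc_connected_trans less_Suc_eq)
qed

lemma (in pre_digraph) awalk_meets_cut_arcs:
  assumes "awalk u p v" and "u \<in> C" and "v \<notin> C"
  shows "set p \<inter> cut_arcs G C \<noteq> {}"
proof -
  have "set p \<subseteq> arcs G" and "cas u p v"
    using assms(1) by (auto simp: awalk_def)
  then show ?thesis
    using assms(2)
  proof (induction p arbitrary: u)
    case Nil
    with assms(3) show ?case by simp
  next
    case (Cons a p)
    then show ?case
      by (cases "head G a \<in> C") (auto simp: cut_arcs_def)
  qed
qed

lemma arc_connected_if_arc_disjoint_awalks:
  assumes "finite (arcs G)"
    and walks: "\<And>i. i \<in> I \<Longrightarrow> pre_digraph.awalk G u (w i) v"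
    and disjoint: "disjoint_family_on (\<lambda>i. set (w i)) I"
  shows "arc_connected G (card I) u v"
  unfolding arc_connected_def
proof
  fix C assume "C \<in> st_cuts G u v"
  then have "\<forall>i \<in> I. \<exists>a. a \<in> set (w i) \<inter> cut_arcs G C"
    using pre_digraph.awalk_meets_cut_arcs[OF walks] by (fastforce simp: st_cuts_def)
  then obtain a where a: "\<And>i. i \<in> I \<Longrightarrow> a i \<in> set (w i) \<inter> cut_arcs G C"
    by metis
  have "inj_on a I"
    using a disjoint by (fastforce simp: inj_on_def disjoint_family_on_def)
  moreover have "a ` I \<subseteq> cut_arcs G C"
    using a by auto
  moreover have "finite (cut_arcs G C)"
    using assms(1) by (simp add: cut_arcs_def)
  ultimately show "card I \<le> cut_size G C"
    unfolding cut_size_eq_card_cut_arcs by (rule card_inj_on_le)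
qed

lemma awalk_del_arcs:
  "pre_digraph.awalk (del_arcs G F) u p v \<longleftrightarrow> pre_digraph.awalk G u p v \<and> set p \<inter> F = {}"
proof -
  have "pre_digraph.cas (del_arcs G F) u p v = pre_digraph.cas G u p v"
    by (induction p arbitrary: u) (simp_all add: pre_digraph.cas.simps)
  then show ?thesis
    by (auto simp: pre_digraph.awalk_def)
qed

section \<open>Blocks in series\<close>

text \<open>For \<open>k = 1\<close> a block still needs the two paths that a failure breaks; hence its capacity \<open>c\<close> may
  exceed \<open>k\<close> by one.\<close>

locale block_chain =
  fixes n k c r L :: nat
  assumes r_pos: "0 < r"
    and r_le: "2 * r \<le> c"
    and k_le: "k \<le> c"
    and c_le: "c \<le> Suc k"
    and fits: "L * (2 * r + 1) + 2 \<le> n"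
begin

text \<open>The vertex \<open>port l\<close> is the entry of block \<open>l\<close> and the exit of block \<open>l - 1\<close>; the source
  is \<open>port 0 = 0\<close>. The inner vertices \<open>a\<^sub>i\<close> and \<open>b\<^sub>j\<close> of block \<open>l\<close> are \<open>inner l i\<close> and
  \<open>inner l (r + j)\<close>.\<close>

definition port :: "nat \<Rightarrow> nat" where
  "port l = l * (2 * r + 1)"

definition inner :: "nat \<Rightarrow> nat \<Rightarrow> nat" where
  "inner l q = Suc (port l + q)"

definition sink :: nat where
  "sink = Suc (port L)"

text \<open>Strands beyond the first \<open>2 * r\<close> only raise the capacity of a block to \<open>c\<close>.\<close>

definition strand :: "nat \<Rightarrow> nat \<Rightarrow> marc list" where
  "strand l q =
     (if q < 2 * r then [(port l, inner l q, 0), (inner l q, port (Suc l), 0)]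
      else [(port l, port (Suc l), q)])"

definition bridge :: "nat \<Rightarrow> nat \<Rightarrow> nat \<Rightarrow> marc" where
  "bridge l i j = (inner l i, inner l (r + j), 0)"

definition block_arcs :: "(nat \<times> nat \<times> nat) set \<Rightarrow> nat \<Rightarrow> marc set" where
  "block_arcs B l =
     (\<Union>q<c. set (strand l q)) \<union>
     (\<lambda>(i, j). bridge l i j) ` {(i, j) \<in> {..<r} \<times> {..<r}. (l, i, j) \<in> B}"

definition bundle_arcs :: "marc set" where
  "bundle_arcs = (\<lambda>d. (port L, sink, d)) ` {..<k}"

definition chain :: "(nat \<times> nat \<times> nat) set \<Rightarrow> multidigraph" where
  "chain B = \<lparr>verts = {..<n}, arcs = bundle_arcs \<union> (\<Union>l<L. block_arcs B l),
     tail = (\<lambda>(u, v, i). u), head = (\<lambda>(u, v, i). v)\<rparr>"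

definition failure :: "nat \<Rightarrow> nat \<Rightarrow> nat \<Rightarrow> marc set" where
  "failure l i j = {(inner l i, port (Suc l), 0), (port l, inner l (r + j), 0)}"

abbreviation damaged_chain :: "(nat \<times> nat \<times> nat) set \<Rightarrow> nat \<Rightarrow> nat \<Rightarrow> nat \<Rightarrow> multidigraph" where
  "damaged_chain B l i j \<equiv> del_arcs (chain B) (failure l i j)"

subsection \<open>Layout of the vertices and arcs\<close>

lemma port_0 [simp]: "port 0 = 0"
  by (simp add: port_def)

lemma port_Suc: "port (Suc l) = Suc (port l + 2 * r)"
  by (simp add: port_def)

lemma port_mono: "l \<le> l' \<Longrightarrow> port l \<le> port l'"
  unfolding port_def by (rule mult_right_mono) auto

lemma sink_less: "sink < n"
  using fits by (simp add: sink_def port_def)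

lemma port_less: "l \<le> L \<Longrightarrow> port l < n"
  using port_mono[of l L] sink_less by (simp add: sink_def)

lemma verts_chain [simp]: "verts (chain B) = {..<n}"
  and tail_chain [simp]: "tail (chain B) (u, v, d) = u"
  and head_chain [simp]: "head (chain B) (u, v, d) = v"
  by (simp_all add: chain_def)

lemma arcs_chain: "arcs (chain B) = bundle_arcs \<union> (\<Union>l<L. block_arcs B l)"
  by (simp add: chain_def)

lemma finite_arcs_chain: "finite (arcs (chain B))"
proof -
  have "finite {(i, j) \<in> {..<r} \<times> {..<r}. (l, i, j) \<in> B}" for l
    by (rule finite_subset[of _ "{..<r} \<times> {..<r}"]) auto
  then show ?thesis
    by (simp add: arcs_chain block_arcs_def bundle_arcs_def)
qed

lemma block_arcs_bounds:
  assumes "(u, v, d) \<in> block_arcs B l"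
  shows "port l \<le> u" "u < v" "v \<le> port (Suc l)"
  using assms
  by (auto simp: block_arcs_def strand_def bridge_def inner_def port_Suc split: if_splits)

lemma bundle_arcs_bounds:
  assumes "(u, v, d) \<in> bundle_arcs"
  shows "u = port L" "v = sink"
  using assms by (auto simp: bundle_arcs_def)

lemma block_arcs_disjoint:
  assumes "l \<noteq> l'"
  shows "block_arcs B l \<inter> block_arcs B l' = {}"
proof -
  have "(u, v, d) \<notin> block_arcs B l'" if "(u, v, d) \<in> block_arcs B l" for u v d
    using block_arcs_bounds[OF that] block_arcs_bounds[of u v d B l']
      port_mono[of "Suc l" l'] port_mono[of "Suc l'" l] assms by linarith
  then show ?thesis
    by auto
qed

lemma bundle_block_arcs_disjoint:
  assumes "l < L"
  shows "bundle_arcs \<inter> block_arcs B l = {}"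
proof -
  have "(u, v, d) \<notin> bundle_arcs" if "(u, v, d) \<in> block_arcs B l" for u v d
    using block_arcs_bounds[OF that] bundle_arcs_bounds(1)[of u v d] port_mono[of "Suc l" L]
      assms by linarith
  then show ?thesis
    by auto
qed

lemma multidigraph_on_chain: "multidigraph_on n (chain B)"
proof -
  have bounds: "u < n \<and> v < n" if arc: "(u, v, d) \<in> arcs (chain B)" for u v d
  proof -
    consider (in_bundle) "(u, v, d) \<in> bundle_arcs"
      | (in_block) l where "l < L" "(u, v, d) \<in> block_arcs B l"
      using arc by (auto simp: arcs_chain)
    then show ?thesis
    proof cases
      case in_bundle
      then show ?thesis
        by (metis bundle_arcs_bounds port_less sink_less order_refl)
    next
      case in_block
      then show ?thesis
        using block_arcs_bounds[OF in_block(2)] port_less[of "Suc l"] in_block(1) by linarith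
    qed
  qed
  have "fin_digraph (chain B)"
  proof
    fix a assume "a \<in> arcs (chain B)"
    with bounds show "tail (chain B) a \<in> verts (chain B)" "head (chain B) a \<in> verts (chain B)"
      by (cases a; simp)+
  qed (simp_all add: finite_arcs_chain)
  then show ?thesis
    by (simp add: multidigraph_on_def chain_def)
qed

lemma failure_subset:
  assumes "i < r" and "j < r"
  shows "failure l i j \<subseteq> block_arcs B l"
proof -
  have "failure l i j \<subseteq> set (strand l i) \<union> set (strand l (r + j))"
    using assms by (simp add: failure_def strand_def)
  also have "\<dots> \<subseteq> block_arcs B l"
    using assms r_le by (auto simp: block_arcs_def)
  finally show ?thesis .
qed

lemma failure_subset_arcs:
  assumes "l < L" and "i < r" and "j < r"
  shows "failure l i j \<subseteq> arcs (chain B)"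
  using failure_subset[OF assms(2,3), of l B] assms(1) by (auto simp: arcs_chain)

lemma finite_failure: "finite (failure l i j)"
  and card_failure: "card (failure l i j) = 2"
  by (simp_all add: failure_def inner_def)

subsection \<open>Disjoint walks through the chain\<close>

lemma awalk_strand:
  assumes "l < L" and "q < c"
  shows "pre_digraph.awalk (chain B) (port l) (strand l q) (port (Suc l))"
  using assms port_less[of l]
  by (auto simp: pre_digraph.awalk_def pre_digraph.cas.simps strand_def arcs_chain block_arcs_def
      split: if_splits)

lemma strands_disjoint: "disjoint_family_on (\<lambda>q. set (strand l q)) A"
  by (auto simp: disjoint_family_on_def strand_def inner_def port_Suc)

lemma arc_connected_intact_block:
  assumes "l < L" and "block_arcs B l \<inter> F = {}"
  shows "arc_connected (del_arcs (chain B) F) c (port l) (port (Suc l))"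
proof -
  have "pre_digraph.awalk (del_arcs (chain B) F) (port l) (strand l q) (port (Suc l))"
    if "q < c" for q
    using assms that awalk_strand by (auto simp: awalk_del_arcs block_arcs_def)
  then have "arc_connected (del_arcs (chain B) F) (card {..<c}) (port l) (port (Suc l))"
    by (intro arc_connected_if_arc_disjoint_awalks[OF _ _ strands_disjoint])
      (simp_all add: finite_arcs_chain)
  then show ?thesis
    by simp
qed

lemma arc_connected_intact_bundle:
  assumes "bundle_arcs \<inter> F = {}"
  shows "arc_connected (del_arcs (chain B) F) k (port L) sink"
proof -
  have "pre_digraph.awalk (del_arcs (chain B) F) (port L) [(port L, sink, d)] sink"
    if "d < k" for d
    using assms that port_less[of L] sink_less
    by (auto simp: awalk_del_arcs pre_digraph.awalk_def pre_digraph.cas.simps arcs_chain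
        bundle_arcs_def)
  then have "arc_connected (del_arcs (chain B) F) (card {..<k}) (port L) sink"
    by (intro arc_connected_if_arc_disjoint_awalks[where w = "\<lambda>d. [(port L, sink, d)]"])
      (simp_all add: finite_arcs_chain disjoint_family_on_def)
  then show ?thesis
    by simp
qed

definition detour :: "nat \<Rightarrow> nat \<Rightarrow> nat \<Rightarrow> marc list" where
  "detour l i j = [(port l, inner l i, 0), bridge l i j, (inner l (r + j), port (Suc l), 0)]"

lemma awalk_detour:
  assumes "l < L" "i < r" "j < r" "(l, i, j) \<in> B"
  shows "pre_digraph.awalk (damaged_chain B l i j) (port l) (detour l i j) (port (Suc l))"
proof -
  have "bridge l i j \<in> block_arcs B l"
    using assms(2-4) by (auto simp: block_arcs_def)
  moreover have "(port l, inner l i, 0) \<in> set (strand l i)"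
    "(inner l (r + j), port (Suc l), 0) \<in> set (strand l (r + j))"
    using assms(2,3) by (simp_all add: strand_def)
  then have "{(port l, inner l i, 0), (inner l (r + j), port (Suc l), 0)} \<subseteq> block_arcs B l"
    using assms(2,3) r_le by (auto simp: block_arcs_def)
  ultimately have "set (detour l i j) \<subseteq> arcs (chain B)"
    using assms(1) by (auto simp: detour_def arcs_chain)
  moreover have "set (detour l i j) \<inter> failure l i j = {}"
    using assms(2,3) by (auto simp: detour_def failure_def bridge_def inner_def port_Suc)
  ultimately show ?thesis
    using assms(1) port_less[of l]
    by (simp add: awalk_del_arcs pre_digraph.awalk_def pre_digraph.cas.simps detour_def bridge_def)
qed

lemma arc_connected_bridged_block:
  assumes "l < L" "i < r" "j < r" "(l, i, j) \<in> B"
  shows "arc_connected (damaged_chain B l i j) (c - 1) (port l) (port (Suc l))"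
proof -
  let ?walk = "(strand l)(i := detour l i j)"
  let ?I = "{..<c} - {r + j}"
  have "pre_digraph.awalk (damaged_chain B l i j) (port l) (?walk q) (port (Suc l))"
    if "q \<in> ?I" for q
  proof (cases "q = i")
    case True
    with awalk_detour[OF assms] show ?thesis by simp
  next
    case False
    with that have "set (strand l q) \<inter> failure l i j = {}"
      by (auto simp: strand_def failure_def inner_def port_Suc)
    with False that awalk_strand[OF assms(1)] show ?thesis
      by (simp add: awalk_del_arcs)
  qed
  moreover have "disjoint_family_on (\<lambda>q. set (?walk q)) ?I"
  proof -
    have "set (strand l q) \<inter> set (detour l i j) = {}" if "q \<noteq> i" "q \<noteq> r + j" for q
      using that assms(2,3)
      by (auto simp: strand_def detour_def bridge_def inner_def port_Suc)
    then show ?thesis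
      using strands_disjoint[of l ?I] by (simp add: disjoint_family_on_def Int_commute)
  qed
  ultimately have "arc_connected (damaged_chain B l i j) (card ?I) (port l) (port (Suc l))"
    by (intro arc_connected_if_arc_disjoint_awalks) (simp_all add: finite_arcs_chain)
  moreover have "card ?I = c - 1"
    using assms(3) r_le by simp
  ultimately show ?thesis
    by simp
qed

lemma le_min_cut_size_chain:
  assumes "\<And>l. l < L \<Longrightarrow> arc_connected (del_arcs (chain B) F) m (port l) (port (Suc l))"
    and "arc_connected (del_arcs (chain B) F) m (port L) sink"
  shows "m \<le> min_cut_size (del_arcs (chain B) F) 0 sink"
proof -
  have "arc_connected (del_arcs (chain B) F) m (port 0) (port L)"
    using assms(1) by (rule arc_connected_chain) (simp_all add: port_less)
  from arc_connected_trans[OF this assms(2)] have "arc_connected (del_arcs (chain B) F) m 0 sink"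
    using port_less[of L] by simp
  then show ?thesis
    using port_less[of 0] by (subst le_min_cut_size_iff) (simp_all add: sink_def)
qed

lemma min_cut_size_failure_ge_if_bridge:
  assumes "l < L" "i < r" "j < r" "(l, i, j) \<in> B"
  shows "c - 1 \<le> min_cut_size (damaged_chain B l i j) 0 sink"
proof (rule le_min_cut_size_chain)
  fix l' assume "l' < L"
  show "arc_connected (damaged_chain B l i j) (c - 1) (port l') (port (Suc l'))"
  proof (cases "l' = l")
    case True
    with arc_connected_bridged_block[OF assms] show ?thesis by simp
  next
    case False
    then have "block_arcs B l' \<inter> failure l i j = {}"
      using block_arcs_disjoint[of l' l B] failure_subset[OF assms(2,3), of l B] by auto
    with \<open>l' < L\<close> show ?thesis
      by (rule arc_connected_mono[OF arc_connected_intact_block]) simp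
  qed
next
  have "bundle_arcs \<inter> failure l i j = {}"
    using bundle_block_arcs_disjoint[OF assms(1)] failure_subset[OF assms(2,3)] by blast
  then show "arc_connected (damaged_chain B l i j) (c - 1) (port L) sink"
    by (rule arc_connected_mono[OF arc_connected_intact_bundle]) (use c_le in simp)
qed

subsection \<open>Small cuts\<close>

lemma cut_arcs_initial_segment:
  assumes "l < L" and "{..port l} \<subseteq> C" and "C \<subseteq> {..<port (Suc l)}"
  shows "cut_arcs (chain B) C \<subseteq> block_arcs B l"
proof clarify
  fix u v d assume "(u, v, d) \<in> cut_arcs (chain B) C"
  then have arc: "(u, v, d) \<in> arcs (chain B)" and "u < port (Suc l)" and "port l < v"
    using assms(2,3) by (auto simp: cut_arcs_def not_le[symmetric])
  have "(u, v, d) \<notin> bundle_arcs"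
    using \<open>u < port (Suc l)\<close> bundle_arcs_bounds(1) port_mono[of "Suc l" L] assms(1) by fastforce
  with arc obtain l' where l': "(u, v, d) \<in> block_arcs B l'"
    by (auto simp: arcs_chain)
  have "l' \<le> l"
    using block_arcs_bounds(1)[OF l'] \<open>u < port (Suc l)\<close> port_mono[of "Suc l" l'] by fastforce
  moreover have "l \<le> l'"
    using block_arcs_bounds(3)[OF l'] \<open>port l < v\<close> port_mono[of "Suc l'" l] by fastforce
  ultimately show "(u, v, d) \<in> block_arcs B l"
    using l' by simp
qed

definition block_cut :: "nat \<Rightarrow> nat set \<Rightarrow> nat set" where
  "block_cut l S = {..port l} \<union> inner l ` S"

lemma port_in_block_cut [simp]: "port l \<in> block_cut l S"
  and inner_in_block_cut_iff [simp]: "inner l q \<in> block_cut l S \<longleftrightarrow> q \<in> S"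
  by (auto simp: block_cut_def inner_def)

lemma block_cut_subset: "S \<subseteq> {..<2 * r} \<Longrightarrow> block_cut l S \<subseteq> {..<port (Suc l)}"
  by (auto simp: block_cut_def inner_def port_Suc)

lemma exit_notin_block_cut: "S \<subseteq> {..<2 * r} \<Longrightarrow> port (Suc l) \<notin> block_cut l S"
  using block_cut_subset by blast

lemma block_cut_in_st_cuts:
  assumes "l < L" and "S \<subseteq> {..<2 * r}"
  shows "block_cut l S \<in> st_cuts (chain B) 0 sink"
proof -
  have "port (Suc l) < sink"
    using port_mono[of "Suc l" L] assms(1) by (simp add: sink_def)
  moreover have "0 \<in> block_cut l S"
    by (simp add: block_cut_def)
  ultimately show ?thesis
    using block_cut_subset[OF assms(2), of l] sink_less by (auto simp: st_cuts_def)
qed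

lemma cut_size_block_cut_le:
  assumes "l < L" and S: "S \<subseteq> {..<2 * r}"
    and unbridged: "\<And>i j. \<lbrakk>i \<in> S; i < r; j < r; (l, i, j) \<in> B\<rbrakk> \<Longrightarrow> r + j \<in> S"
  shows "cut_size (chain B) (block_cut l S) \<le> c"
proof -
  define crossing where "crossing q = (if q \<in> S then last (strand l q) else hd (strand l q))" for q
  have "cut_arcs (chain B) (block_cut l S) \<subseteq> crossing ` {..<c}"
  proof clarify
    fix u v d assume cut: "(u, v, d) \<in> cut_arcs (chain B) (block_cut l S)"
    then have u: "u \<in> block_cut l S" and v: "v \<notin> block_cut l S"
      by (simp_all add: cut_arcs_def)
    have "(u, v, d) \<in> block_arcs B l"
      using cut cut_arcs_initial_segment[OF assms(1) _ block_cut_subset[OF S]]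
      by (auto simp: block_cut_def)
    then consider (strand) q where "q < c" "(u, v, d) \<in> set (strand l q)"
      | (bridge) i j where "i < r" "j < r" "(l, i, j) \<in> B" "(u, v, d) = bridge l i j"
      by (auto simp: block_arcs_def)
    then show "(u, v, d) \<in> crossing ` {..<c}"
    proof cases
      case strand
      then have "(u, v, d) = crossing q"
        using u v S exit_notin_block_cut[OF S]
        by (auto simp: crossing_def strand_def split: if_splits)
      with strand(1) show ?thesis by blast
    next
      case bridge
      with u v unbridged show ?thesis by (auto simp: bridge_def)
    qed
  qed
  then have "cut_size (chain B) (block_cut l S) \<le> card {..<c}"
    unfolding cut_size_eq_card_cut_arcs by (rule surj_card_le[rotated]) simp
  then show ?thesis
    by simp
qed

lemma min_cut_size_failure_le_if_no_bridge:
  assumes "l < L" "i < r" "j < r" "(l, i, j) \<notin> B"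
  shows "min_cut_size (damaged_chain B l i j) 0 sink \<le> c - 2"
proof -
  let ?S = "insert i ({r..<2 * r} - {r + j})"
  let ?C = "block_cut l ?S"
  have S: "?S \<subseteq> {..<2 * r}"
    using assms(2) by auto
  have "failure l i j \<subseteq> cut_arcs (chain B) ?C"
    using failure_subset_arcs[OF assms(1-3), of B] assms(2) exit_notin_block_cut[OF S]
    by (auto simp: cut_arcs_def failure_def)
  then have "cut_size (damaged_chain B l i j) ?C = cut_size (chain B) ?C - 2"
    by (simp add: cut_size_del_arcs finite_failure card_failure)
  also have "\<dots> \<le> c - 2"
    using assms by (intro diff_le_mono cut_size_block_cut_le[OF _ S]) auto
  finally show ?thesis
    using min_cut_size_le[of "damaged_chain B l i j" ?C 0 sink]
      block_cut_in_st_cuts[OF assms(1) S, of B] by simp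
qed

lemma min_cut_size_chain: "min_cut_size (chain B) 0 sink = k"
proof (rule antisym)
  have "cut_arcs (chain B) {..port L} \<subseteq> bundle_arcs"
  proof clarify
    fix u v d assume "(u, v, d) \<in> cut_arcs (chain B) {..port L}"
    then have arc: "(u, v, d) \<in> arcs (chain B)" and "port L < v"
      by (auto simp: cut_arcs_def)
    have "(u, v, d) \<notin> block_arcs B l" if "l < L" for l
      using \<open>port L < v\<close> block_arcs_bounds(3)[of u v d B l] port_mono[of "Suc l" L] that
      by fastforce
    with arc show "(u, v, d) \<in> bundle_arcs"
      by (auto simp: arcs_chain)
  qed
  then have "cut_size (chain B) {..port L} \<le> card bundle_arcs"
    unfolding cut_size_eq_card_cut_arcs by (rule card_mono[rotated]) (simp add: bundle_arcs_def)
  also have "card bundle_arcs = k"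
    by (simp add: bundle_arcs_def card_image inj_on_def)
  finally have "cut_size (chain B) {..port L} \<le> k" .
  moreover have "{..port L} \<in> st_cuts (chain B) 0 sink"
    using port_less[of L] by (auto simp: st_cuts_def sink_def)
  ultimately show "min_cut_size (chain B) 0 sink \<le> k"
    by (metis finite_lessThan min_cut_size_le order_trans verts_chain)
next
  have "k \<le> min_cut_size (del_arcs (chain B) {}) 0 sink"
    by (intro le_min_cut_size_chain arc_connected_intact_bundle
        arc_connected_mono[OF arc_connected_intact_block k_le]) simp_all
  then show "k \<le> min_cut_size (chain B) 0 sink"
    by simp
qed

subsection \<open>Oracles store the bridges\<close>

lemma oracle_answer_failure:
  assumes "dual_ft_oracle M (chain B) 0 sink D" and "l < L" "i < r" "j < r"
  shows "M D 0 sink (failure l i j) = min_cut_size (damaged_chain B l i j) 0 sink"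
  using assms(1) failure_subset_arcs[OF assms(2-4)] card_failure by (simp add: dual_ft_oracle_def)

lemma oracle_decides_bridge:
  assumes "dual_ft_oracle M (chain B) 0 sink D" and "l < L" "i < r" "j < r"
  shows "(l, i, j) \<in> B \<longleftrightarrow> c - 1 \<le> M D 0 sink (failure l i j)"
proof -
  have "c - 2 < c - 1"
    using r_pos r_le by simp
  then show ?thesis
    unfolding oracle_answer_failure[OF assms]
    using min_cut_size_failure_ge_if_bridge[OF assms(2-4)]
      min_cut_size_failure_le_if_no_bridge[OF assms(2-4)] by fastforce
qed

lemma exists_chain_with_large_oracles:
  "\<exists>B. \<forall>D. dual_ft_oracle M (chain B) 0 sink D \<longrightarrow> L * r * r \<le> length D"
proof -
  let ?U = "{..<L} \<times> {..<r} \<times> {..<r}"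
  have "\<exists>B \<in> Pow ?U. \<forall>D. dual_ft_oracle M (chain B) 0 sink D \<longrightarrow> L * r * r \<le> length D"
  proof (rule exists_only_long_codes)
    show "2 ^ (L * r * r) \<le> card (Pow ?U)"
      by (simp add: card_Pow card_cartesian_product mult.assoc)
    fix B B' D
    assume subsets: "B \<in> Pow ?U" "B' \<in> Pow ?U"
      and oracles: "dual_ft_oracle M (chain B) 0 sink D" "dual_ft_oracle M (chain B') 0 sink D"
    have "(l, i, j) \<in> B \<longleftrightarrow> (l, i, j) \<in> B'" if "(l, i, j) \<in> ?U" for l i j
      using that oracles[THEN oracle_decides_bridge, of l i j] by simp
    with subsets show "B = B'"
      by blast
  qed
  then show ?thesis
    by blast
qed

end

section \<open>The lower bound\<close>

lemma le_double_div_mult: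
  fixes a b :: nat
  assumes "0 < b" and "b \<le> a"
  shows "a \<le> 2 * (a div b * b)"
proof -
  have "1 * b \<le> a div b * b"
    using assms by (intro mult_right_mono) (simp_all add: Suc_le_eq div_greater_zero_iff)
  then show ?thesis
    using dividend_less_div_times[OF assms(1), of a] by linarith
qed

lemma bit_count_bound:
  fixes n k r :: nat
  assumes "9 \<le> n" and "k \<le> n" and r: "r = (k + 3) div 4" and "0 < r"
  shows "k * n \<le> 48 * (((n - 2) div (2 * r + 1)) * r * r)"
proof -
  let ?L = "(n - 2) div (2 * r + 1)"
  have "n - 2 \<le> 2 * (?L * (2 * r + 1))"
    using assms by (intro le_double_div_mult) linarith+
  also have "\<dots> \<le> 2 * (?L * (3 * r))"
    using \<open>0 < r\<close> by (intro mult_left_mono) auto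
  finally have "n \<le> 12 * ?L * r"
    using \<open>9 \<le> n\<close> by linarith
  moreover have "k \<le> 4 * r"
    unfolding r by linarith
  ultimately have "k * n \<le> (4 * r) * (12 * ?L * r)"
    by (intro mult_mono) auto
  then show ?thesis
    by (simp add: ac_simps)
qed

lemma exists_block_chain:
  fixes n k :: nat
  assumes "2 \<le> n" and "1 \<le> k" and "k \<le> n"
  shows "\<exists>c r L. block_chain n k c r L \<and> (9 \<le> n \<longrightarrow> k * n \<le> 48 * (L * r * r))"
proof -
  define r where "r = (k + 3) div 4"
  define L where "L = (n - 2) div (2 * r + 1)"
  have "0 < r" and "2 * r \<le> Suc k"
    using \<open>1 \<le> k\<close> unfolding r_def by linarith+
  have "L * (2 * r + 1) \<le> n - 2"
    unfolding L_def by (rule div_times_less_eq_dividend)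
  then have "L * (2 * r + 1) + 2 \<le> n"
    using \<open>2 \<le> n\<close> by linarith
  with \<open>0 < r\<close> \<open>2 * r \<le> Suc k\<close> have "block_chain n k (max k (2 * r)) r L"
    by unfold_locales auto
  moreover have "9 \<le> n \<longrightarrow> k * n \<le> 48 * (L * r * r)"
    unfolding L_def using bit_count_bound[OF _ \<open>k \<le> n\<close> r_def \<open>0 < r\<close>] by blast
  ultimately show ?thesis
    by blast
qed

theorem theorem4:
  shows "\<exists>c::real. c > 0 \<and> (\<exists>N::nat. \<forall>(M::machine) (n::nat) (k::nat).
           2 \<le> n \<and> 1 \<le> k \<and> k \<le> n \<longrightarrow>
           (\<exists>G s t. multidigraph_on n G \<and> s \<in> verts G \<and> t \<in> verts G \<and> s \<noteq> t \<and>
              min_cut_size G s t = k \<and>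
              (N \<le> n \<longrightarrow>
                (\<forall>D. dual_ft_oracle M G s t D \<longrightarrow> c * real k * real n \<le> real (length D)))))"
proof (intro exI[of _ "1 / 48 :: real"] conjI exI[of _ "9 :: nat"] allI impI)
  fix M :: machine and n k :: nat
  assume "2 \<le> n \<and> 1 \<le> k \<and> k \<le> n"
  then obtain c r L where "block_chain n k c r L" and bits: "9 \<le> n \<Longrightarrow> k * n \<le> 48 * (L * r * r)"
    using exists_block_chain by blast
  interpret block_chain n k c r L by fact
  obtain B where B: "\<And>D. dual_ft_oracle M (chain B) 0 sink D \<Longrightarrow> L * r * r \<le> length D"
    using exists_chain_with_large_oracles by blast
  have "1 / 48 * real k * real n \<le> real (length D)"
    if "9 \<le> n" and "dual_ft_oracle M (chain B) 0 sink D" for D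
  proof -
    have "k * n \<le> 48 * length D"
      using bits[OF that(1)] B[OF that(2)] by linarith
    then show ?thesis
      by (simp flip: of_nat_mult)
  qed
  then show "\<exists>G s t. multidigraph_on n G \<and> s \<in> verts G \<and> t \<in> verts G \<and> s \<noteq> t \<and>
      min_cut_size G s t = k \<and>
      (9 \<le> n \<longrightarrow> (\<forall>D. dual_ft_oracle M G s t D \<longrightarrow> 1 / 48 * real k * real n \<le> real (length D)))"
    using multidigraph_on_chain min_cut_size_chain sink_less
    by (intro exI[of _ "chain B"] exI[of _ 0] exI[of _ sink]) (auto simp: sink_def)
qed simp

end
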